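(* Let $n\geq 3$ be an integer, let $(x_1,\ldots,x_n)$ be positive integers with $x_1\leq\cdots\leq x_n$, and let $m$ be an integer with $$m=\sigma_2(x_1,\ldots,x_n)=\sigma_n(x_1,\ldots,x_n).$$ Then $m\leq n^2(3n-5)$ and $x_n\leq\frac{1}{2}n(3n-5)$.
   Context: $\sigma_k$ denotes the $k$-th elementary symmetric polynomial in $n$ variables. *)

theory Defs
  imports Complex_Main
begin

definition elem_sym :: "nat \<Rightarrow> nat \<Rightarrow> (nat \<Rightarrow> 'a::comm_semiring_1) \<Rightarrow> 'a" where
  "elem_sym n k x = (\<Sum>S | S \<subseteq> {1..n} \<and> card S = k. \<Prod>i\<in>S. x i)"

end

theory Submission
  imports Defs "HOL-Analysis.Convex"
begin

text \<open>
  Write \<open>N = n - 1\<close> and let \<open>P\<close>, \<open>S\<close>, \<open>Q\<close> be the product, the sum and the second elementary symmetric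
  polynomial of \<open>x\<^sub>1, \<dots>, x\<^sub>N\<close>. The hypothesis reads \<open>x\<^sub>n d = Q\<close> with \<open>d = P - S \<ge> 1\<close>. Put
  \<open>u\<^sub>i = x\<^sub>i - 1\<close>. Expanding \<open>P\<close> gives \<open>\<sigma>\<^sub>2(u) \<le> N - 1 + d\<close>, and \<open>\<sigma>\<^sub>1(u) \<le> 1 + \<sigma>\<^sub>2(u)\<close> since at least
  two of the \<open>u\<^sub>i\<close> are nonzero. Hence \<open>x\<^sub>n d = Q \<le> A + N d\<close> and \<open>P \<le> 2 (N + d)\<close>, where
  \<open>2 A = (N - 1) (3 N + 2)\<close>. The first inequality with \<open>d \<ge> 1\<close> bounds \<open>x\<^sub>n\<close>; both together
  bound \<open>m = x\<^sub>n P\<close> as long as \<open>d \<le> A\<close>. If \<open>d > A\<close>, then all \<open>x\<^sub>i\<close> are at most \<open>N\<close>, and concavity of the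
  logarithm converts \<open>2 \<Prod>x\<^sub>i = 2 m \<le> (\<Sum>x\<^sub>i)\<^sup>2\<close> into the linear bound \<open>\<Sum>(x\<^sub>i - 1) \<le> 4 (N - 1)\<close>, whence
  \<open>m\<close> is only quadratic in \<open>n\<close>.
\<close>

section \<open>Second elementary symmetric polynomial over a finite set\<close>

text \<open>An arbitrary index set permits induction by \<open>insert\<close> and splitting off the
  largest entry.\<close>

definition sigma2 :: "'b set \<Rightarrow> ('b \<Rightarrow> 'a::comm_semiring_1) \<Rightarrow> 'a" where
  "sigma2 A x = (\<Sum>S | S \<subseteq> A \<and> card S = 2. \<Prod>i\<in>S. x i)"

lemma sigma2_empty [simp]: "sigma2 {} x = 0"
proof -
  have "{S::'b set. S \<subseteq> {} \<and> card S = 2} = {}"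
    by auto
  then show ?thesis
    by (simp only: sigma2_def sum.empty)
qed

lemma sigma2_insert:
  assumes "finite A" "a \<notin> A"
  shows "sigma2 (insert a A) x = sigma2 A x + x a * sum x A"
proof -
  have split: "{S. S \<subseteq> insert a A \<and> card S = 2} =
      {S. S \<subseteq> A \<and> card S = 2} \<union> (\<lambda>b. {a, b}) ` A"
    using assms by (auto simp: card_2_iff)
  have "inj_on (\<lambda>b. {a, b}) A"
    by (auto simp: inj_on_def doubleton_eq_iff)
  then have "(\<Sum>S\<in>(\<lambda>b. {a, b}) ` A. \<Prod>i\<in>S. x i) = (\<Sum>b\<in>A. \<Prod>i\<in>{a, b}. x i)"
    by (simp add: sum.reindex)
  also have "\<dots> = (\<Sum>b\<in>A. x a * x b)"
  proof (rule sum.cong)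
    fix b
    assume "b \<in> A"
    then have "a \<noteq> b"
      using assms by auto
    then show "(\<Prod>i\<in>{a, b}. x i) = x a * x b"
      by simp
  qed simp
  finally show ?thesis
    unfolding sigma2_def split using assms
    by (subst sum.union_disjoint) (auto simp: sum_distrib_left)
qed

lemma double_sigma2:
  fixes x :: "'b \<Rightarrow> 'a::comm_ring_1"
  assumes "finite A"
  shows "2 * sigma2 A x = (sum x A)\<^sup>2 - (\<Sum>i\<in>A. (x i)\<^sup>2)"
  using assms by (induction A) (simp_all add: sigma2_insert power2_eq_square algebra_simps)

lemma sigma2_nonneg:
  fixes u :: "'b \<Rightarrow> 'a::linordered_idom"
  assumes "\<And>i. i \<in> A \<Longrightarrow> u i \<ge> 0"
  shows "sigma2 A u \<ge> 0"
  unfolding sigma2_def using assms by (intro sum_nonneg prod_nonneg) auto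

text \<open>Each \<open>u i\<close> lies in \<open>k - 1\<close> of the pairs; doubling avoids
  halving the number of pairs.\<close>

lemma double_sigma2_shift:
  fixes u :: "'b \<Rightarrow> 'a::comm_ring_1"
  assumes "finite A"
  defines "k \<equiv> of_nat (card A)"
  shows "2 * sigma2 A (\<lambda>i. 1 + u i) = k * (k - 1) + 2 * (k - 1) * sum u A + 2 * sigma2 A u"
  unfolding double_sigma2[OF assms(1)] k_def
  by (simp add: power2_eq_square algebra_simps sum.distrib flip: sum_distrib_right sum_distrib_left)

text \<open>The left side is the expansion of the product cut off after degree two; the dropped
  terms are nonnegative.\<close>

lemma prod_one_plus_ge:
  fixes u :: "'b \<Rightarrow> 'a::linordered_idom"
  assumes "finite A" "\<And>i. i \<in> A \<Longrightarrow> u i \<ge> 0"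
  shows "1 + sum u A + sigma2 A u \<le> (\<Prod>i\<in>A. 1 + u i)"
  using assms
proof (induction A)
  case (insert a A)
  have "(1 + u a) * (1 + sum u A + sigma2 A u) \<le> (1 + u a) * (\<Prod>i\<in>A. 1 + u i)"
    using insert by (intro mult_left_mono) auto
  moreover have "u a * sigma2 A u \<ge> 0"
    using insert.prems by (intro mult_nonneg_nonneg sigma2_nonneg) auto
  ultimately show ?case
    using insert.hyps by (simp add: sigma2_insert algebra_simps)
qed simp

text \<open>The second alternative is the case of at most one nonzero \<open>u i\<close>.\<close>

lemma sum_le_Suc_sigma2:
  fixes u :: "'b \<Rightarrow> int"
  assumes "finite A" "\<And>i. i \<in> A \<Longrightarrow> u i \<ge> 0"
  shows "sum u A \<le> 1 + sigma2 A u \<or> (\<Prod>i\<in>A. 1 + u i) = 1 + sum u A"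
  using assms
proof (induction A)
  case (insert a A)
  have nonneg: "sum u A \<ge> 0" "sigma2 A u \<ge> 0" "u a \<ge> 0"
    using insert.prems by (auto intro: sum_nonneg sigma2_nonneg)
  consider "u a = 0" | "sum u A = 0" | "u a \<ge> 1" "sum u A \<ge> 1"
    using nonneg by linarith
  then show ?case
  proof cases
    case 1
    then show ?thesis
      using insert by (simp add: sigma2_insert)
  next
    case 2
    then have "\<And>i. i \<in> A \<Longrightarrow> u i = 0"
      using insert by (simp add: sum_nonneg_eq_0_iff)
    then show ?thesis
      using insert.hyps 2 by simp
  next
    case 3
    \<comment> \<open>Expanded, this bounds the new sum by 1 plus \<open>u a * sum u A\<close>,
      which is exactly what \<open>sigma2\<close> gains from \<open>a\<close>.\<close>
    then have "(u a - 1) * (sum u A - 1) \<ge> 0"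
      by simp
    then show ?thesis
      using insert.hyps nonneg by (simp add: sigma2_insert algebra_simps)
  qed
qed simp

section \<open>Logarithmic bound for tuples with small entries\<close>

lemma ln_ge_chord:
  fixes x b :: real
  assumes "1 \<le> x" "x \<le> b" "1 < b"
  shows "(x - 1) * ln b \<le> (b - 1) * ln x"
proof -
  define t where "t = (x - 1) / (b - 1)"
  have t: "0 \<le> t" "t \<le> 1" and x: "x = (1 - t) * 1 + t * b"
    using assms by (auto simp: t_def divide_simps) (auto simp: algebra_simps)
  have "(1 - t) * ln 1 + t * ln b \<le> ln x"
    unfolding x using concave_onD[OF ln_concave t, of 1 b] assms by simp
  then show ?thesis
    using assms by (simp add: t_def field_simps)
qed

text \<open>Summing the chord bound over \<open>A\<close> turns the logarithms into that of the
  product, at most \<open>k * ln b\<close>; then \<open>ln b > 0\<close> cancels.\<close>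

lemma sum_excess_le:
  fixes x :: "'b \<Rightarrow> real"
  assumes "finite A" "b > 1" "\<And>i. i \<in> A \<Longrightarrow> 1 \<le> x i \<and> x i \<le> b" "prod x A \<le> b ^ k"
  shows "(\<Sum>i\<in>A. x i - 1) \<le> real k * (b - 1)"
proof -
  have pos: "\<And>i. i \<in> A \<Longrightarrow> x i > 0"
    using assms(3) by force
  have "(\<Sum>i\<in>A. x i - 1) * ln b = (\<Sum>i\<in>A. (x i - 1) * ln b)"
    by (simp add: sum_distrib_right)
  also have "\<dots> \<le> (\<Sum>i\<in>A. (b - 1) * ln (x i))"
    using assms by (intro sum_mono ln_ge_chord) auto
  also have "\<dots> = (b - 1) * ln (prod x A)"
    using pos assms(1) by (subst ln_prod) (auto simp: sum_distrib_left dest: less_imp_neq[symmetric])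
  also have "\<dots> \<le> (b - 1) * ln (b ^ k)"
    using assms pos by (intro mult_left_mono ln_mono) (auto intro!: prod_pos)
  also have "\<dots> = real k * (b - 1) * ln b"
    using assms by (simp add: ln_realpow)
  finally show ?thesis
    using assms by simp
qed

lemma prod_le_of_bounded:
  fixes x :: "'b \<Rightarrow> int"
  assumes "finite A" and n: "int (card A) = n" "n \<ge> 3"
    and bd: "\<And>i. i \<in> A \<Longrightarrow> 1 \<le> x i \<and> x i \<le> n - 1"
    and eq: "sigma2 A x = prod x A"
  shows "prod x A \<le> n\<^sup>2 * (3 * n - 5)"
proof -
  define T where "T = sum x A"
  have T0: "T \<ge> 0"
    unfolding T_def using bd by (intro sum_nonneg) force
  have "(\<Sum>i\<in>A. (x i)\<^sup>2) \<ge> 0"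
    by (intro sum_nonneg) auto
  then have m: "2 * prod x A \<le> T\<^sup>2"
    using double_sigma2[OF assms(1), of x] by (simp add: eq T_def)
  have "T \<le> (\<Sum>i\<in>A. n - 1)"
    unfolding T_def using bd by (intro sum_mono) auto
  then have "T \<le> n * (n - 1)"
    using n by simp
  then have T2: "T\<^sup>2 \<le> (n * (n - 1))\<^sup>2"
    using T0 by (intro power_mono) auto
  show ?thesis
  proof (cases "n \<le> 6")
    case True
    \<comment> \<open>Here \<open>T \<le> n * (n - 1)\<close> suffices, since
      \<open>(n - 1)\<^sup>2 \<le> 2 * (3 * n - 5)\<close> holds for n from 3 to 6 but fails at
      7.\<close>
    then consider "n = 3" | "n = 4" | "n = 5" | "n = 6"
      using n by linarith
    then show ?thesis
      using m T2 by cases auto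
  next
    case False
    then have "n \<ge> 7"
      by simp
    \<comment> \<open>The aim is to bound the product by a power of \<open>n - 1\<close>, so that
      \<open>sum_excess_le\<close> applies with \<open>b = n - 1\<close> and
      \<open>k = 4\<close>.\<close>
    have "7 * n \<le> n * n"
      using \<open>n \<ge> 7\<close> by simp
    moreover have "2 * (n - 1) * (n - 1) = 2 * (n * n) - 4 * n + 2"
      by (simp add: algebra_simps)
    ultimately have "n * n \<le> 2 * (n - 1) * (n - 1)"
      using n(2) by linarith
    then have "n * n * (n - 1)\<^sup>2 \<le> 2 * (n - 1) * (n - 1) * (n - 1)\<^sup>2"
      by (intro mult_right_mono) auto
    moreover have "2 * (n - 1) * (n - 1) * (n - 1)\<^sup>2 = 2 * (n - 1) ^ 4"
      by (simp only: power2_eq_square power4_eq_xxxx mult.assoc)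
    moreover have "(n * (n - 1))\<^sup>2 = n * n * (n - 1)\<^sup>2"
      by (simp only: power2_eq_square mult_ac)
    ultimately have "prod x A \<le> (n - 1) ^ 4"
      using m T2 by linarith
    then have "real_of_int (prod x A) \<le> real_of_int ((n - 1) ^ 4)"
      by (simp only: of_int_le_iff)
    then have "(\<Prod>i\<in>A. real_of_int (x i)) \<le> (real_of_int n - 1) ^ 4"
      by simp
    moreover have "1 \<le> real_of_int (x i) \<and> real_of_int (x i) \<le> real_of_int n - 1" if "i \<in> A" for i
      using bd[OF that] by linarith
    ultimately have "(\<Sum>i\<in>A. real_of_int (x i) - 1) \<le> real 4 * (real_of_int n - 1 - 1)"
      using \<open>n \<ge> 7\<close> assms(1) by (intro sum_excess_le) auto
    also have "(\<Sum>i\<in>A. real_of_int (x i) - 1) = real_of_int (T - n)"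
      using n by (simp add: sum_subtractf T_def flip: n(1))
    finally have "T \<le> 5 * n - 8"
      by simp
    then have "T\<^sup>2 \<le> (5 * n)\<^sup>2"
      using T0 by (intro power_mono) auto
    also have "\<dots> = n\<^sup>2 * 25"
      by (simp add: power_mult_distrib)
    also have "\<dots> \<le> n\<^sup>2 * (2 * (3 * n - 5))"
      using \<open>n \<ge> 7\<close> by (intro mult_left_mono) auto
    also have "\<dots> = 2 * (n\<^sup>2 * (3 * n - 5))"
      by (rule mult.left_commute)
    finally show ?thesis
      using m by linarith
  qed
qed

section \<open>The two bounds, with the largest entry split off\<close>

lemma sigma2_eq_prod_bounds:
  fixes x :: "'b \<Rightarrow> int" and N :: int
  assumes "finite B" "a \<notin> B" and N: "int (card B) = N" "N \<ge> 2"
    and pos: "\<And>i. i \<in> insert a B \<Longrightarrow> x i \<ge> 1"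
    and max: "\<And>i. i \<in> B \<Longrightarrow> x i \<le> x a"
    and eq: "sigma2 (insert a B) x = prod x (insert a B)"
  shows "2 * x a \<le> (N + 1) * (3 * N - 2)"
    and "prod x (insert a B) \<le> (N + 1)\<^sup>2 * (3 * N - 2)"
proof -
  define u where "u i = x i - 1" for i
  have x_u: "x = (\<lambda>i. 1 + u i)"
    by (simp add: u_def)
  have u: "u i \<ge> 0" if "i \<in> B" for i
    using pos[of i] that by (simp add: u_def)
  define s where "s = sum u B"
  define e where "e = sigma2 B u"
  define Q where "Q = sigma2 B x"
  define P where "P = prod x B"
  define d where "d = P - sum x B"
  have s0: "s \<ge> 0" and e0: "e \<ge> 0"
    using u by (auto simp: s_def e_def intro: sum_nonneg sigma2_nonneg)
  have S: "sum x B = N + s"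
    by (simp add: x_u s_def sum.distrib flip: N(1))
  have Q2: "2 * Q = N * (N - 1) + 2 * (N - 1) * s + 2 * e"
    using double_sigma2_shift[OF assms(1), of u] N(1) by (simp add: Q_def x_u s_def e_def)
  have xd: "x a * d = Q"
    using eq assms by (simp add: sigma2_insert d_def P_def Q_def algebra_simps)
  have "N * (N - 1) > 0" "(N - 1) * s \<ge> 0"
    using N s0 by auto
  then have "Q > 0"
    using Q2 e0 unfolding mult.assoc by linarith
  then have d1: "d \<ge> 1"
    using xd pos[of a] by (smt (verit) insertI1 zero_less_mult_pos)
  have P: "P = N + s + d"
    by (simp add: d_def S)
  have "1 + s + e \<le> P"
    using prod_one_plus_ge[of B u] u assms(1) by (simp add: P_def x_u s_def e_def)
  then have e_le: "e \<le> N - 1 + d"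
    using P by simp
  have "s \<le> 1 + e \<or> P = 1 + s"
    using sum_le_Suc_sigma2[of B u] u assms(1) by (simp add: P_def x_u s_def e_def)
  \<comment> \<open>The alternative \<open>P = 1 + s\<close> would force \<open>N + d = 1\<close>,
    against \<open>N \<ge> 2\<close> and \<open>d \<ge> 1\<close>.\<close>
  then have s_le: "s \<le> N + d"
    using P N d1 e_le by auto
  define A2 where "A2 = (N - 1) * (3 * N + 2)"
  have "2 * (N - 1) * s \<le> 2 * (N - 1) * (N + d)"
    using s_le N by (intro mult_left_mono) auto
  then have key: "2 * (x a * d) \<le> A2 + 2 * N * d"
    unfolding xd using Q2 e_le by (simp add: A2_def algebra_simps)
  have A2: "A2 \<ge> 0"
    unfolding A2_def using N(2) by (intro mult_nonneg_nonneg) auto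
  have A2_N: "A2 + 2 * N = (N + 1) * (3 * N - 2)"
    by (simp add: A2_def algebra_simps)
  have "A2 * 1 \<le> A2 * d"
    using A2 d1 by (intro mult_left_mono)
  then have "(2 * x a) * d \<le> ((N + 1) * (3 * N - 2)) * d"
    using key unfolding A2_N[symmetric] by (simp add: algebra_simps)
  then show "2 * x a \<le> (N + 1) * (3 * N - 2)"
    using d1 by simp
  show "prod x (insert a B) \<le> (N + 1)\<^sup>2 * (3 * N - 2)"
  proof (cases "2 * d \<le> A2")
    case True
    have "prod x (insert a B) * d = P * (x a * d)"
      using assms by (simp add: P_def)
    also have "\<dots> \<le> (2 * N + 2 * d) * (x a * d)"
      using P s_le \<open>Q > 0\<close> xd by (intro mult_right_mono) auto
    also have "\<dots> = (N + d) * (2 * (x a * d))"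
      by (simp add: algebra_simps)
    also have "\<dots> \<le> (N + d) * (A2 + 2 * N * d)"
      using key N d1 by (intro mult_left_mono) auto
    \<comment> \<open>The quadratic in \<open>d\<close> meets the linear bound at
      \<open>d = 1\<close> and at \<open>2 * d = A2\<close>; being convex, it stays below in
      between.\<close>
    also have "\<dots> = (N + 1) * (A2 + 2 * N) * d - N * ((d - 1) * (A2 - 2 * d))"
      by (simp add: algebra_simps)
    also have "\<dots> \<le> (N + 1) * (A2 + 2 * N) * d"
      using N d1 True by simp
    also have "\<dots> = ((N + 1)\<^sup>2 * (3 * N - 2)) * d"
      by (simp only: A2_N power2_eq_square mult.assoc)
    finally show ?thesis
      using d1 by simp
  next
    case False
    \<comment> \<open>Replacing \<open>A2\<close> in \<open>key\<close> by the larger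
      \<open>2 * d\<close> leaves the factor \<open>2 * N + 2\<close>, and the strictness gives
      \<open>x a \<le> N\<close>.\<close>
    then have "(2 * x a) * d < (2 * (N + 1)) * d"
      using key by (simp add: algebra_simps)
    then have "x a \<le> N"
      using d1 by simp
    then have "prod x (insert a B) \<le> (N + 1)\<^sup>2 * (3 * (N + 1) - 5)"
      using assms by (intro prod_le_of_bounded) (auto intro: order_trans)
    then show ?thesis
      by (simp add: algebra_simps)
  qed
qed

theorem theorem2p7:
  fixes n :: nat and x :: "nat \<Rightarrow> int" and m :: int
  assumes "n \<ge> 3"
    and "\<And>i. i \<in> {1..n} \<Longrightarrow> x i > 0"
    and "mono_on {1..n} x"
    and "m = elem_sym n 2 x"
    and "elem_sym n 2 x = elem_sym n n x"
  shows "m \<le> (int n)^2 * (3 * int n - 5)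
       \<and> real_of_int (x n) \<le> 1/2 * real n * (3 * real n - 5)"
proof -
  have "{S. S \<subseteq> {1..n} \<and> card S = n} = {{1..n}}"
    using card_subset_eq[of "{1..n}"] by auto
  then have en: "elem_sym n n x = prod x {1..n}"
    by (simp add: elem_sym_def)
  have e2: "elem_sym n 2 x = sigma2 {1..n} x"
    by (simp add: elem_sym_def sigma2_def)
  \<comment> \<open>By monotonicity the index \<open>n\<close> can play the role of
    \<open>a\<close>, with \<open>N = n - 1\<close>.\<close>
  have ins: "insert n {1..<n} = {1..n}"
    using assms(1) by auto
  have "x i \<le> x n" if "i \<in> {1..<n}" for i
    using assms(3) that by (auto simp: mono_on_def)
  moreover have "x i \<ge> 1" if "i \<in> insert n {1..<n}" for i
    using assms(2)[of i] that unfolding ins by simp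
  moreover have "int (card {1..<n}) = int n - 1"
    using assms(1) by simp
  moreover have "sigma2 (insert n {1..<n}) x = prod x (insert n {1..<n})"
    using assms(5) unfolding ins e2 en .
  ultimately have
    "2 * x n \<le> (int n - 1 + 1) * (3 * (int n - 1) - 2)"
    "prod x (insert n {1..<n}) \<le> (int n - 1 + 1)\<^sup>2 * (3 * (int n - 1) - 2)"
    using assms(1) sigma2_eq_prod_bounds[of "{1..<n}" n "int n - 1" x] by fastforce+
  then have b: "2 * x n \<le> int n * (3 * int n - 5)"
    and "prod x {1..n} \<le> (int n)\<^sup>2 * (3 * int n - 5)"
    unfolding ins by simp_all
  moreover have "2 * real_of_int (x n) \<le> real n * (3 * real n - 5)"
    using b[folded of_int_le_iff[where 'a = real]] by simp
  ultimately show ?thesis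
    using assms(4,5) en by simp
qed

end
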